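(* Let $\epsilon>0$ be an admissible excess threshold, i.e. $\epsilon\in(0,\epsilon^\circ-\epsilon^\star)$. Assume the following. (a) There exists $\Theta_\epsilon\in\mathcal B(\Theta)$ with $\pi[\Theta_\epsilon]>0$ such that, for all sufficiently large $n\in\mathbb N^*$ and $\pi$-almost every $\theta\in\Theta_\epsilon$, there exist coefficients $\alpha_n,\beta_\theta,\gamma_{\theta,n}\in(0,1)$ (with $\theta\mapsto\beta_\theta$ and $\theta\mapsto\gamma_{\theta,n}$ Borel measurable from $\Theta_\epsilon$ to $(0,1)$, up to modification on $\pi$-null sets) satisfying $\alpha_n+\beta_\theta+\gamma_{\theta,n}\le1$ and such that: for $n$ large enough and $\mathbf P$-almost every $\omega\in\Omega$, $\mathcal T_n^\star\le\epsilon\,\alpha_n$; and, for $\pi$-almost every $\theta\in\Theta_\epsilon$, $\mathcal T_\theta^\star\le\epsilon^\star+\epsilon\,\beta_\theta$. (b) For $\pi$-almost every $\theta\in\Theta_\epsilon$, $\bar\gamma_\theta:=\liminf_{n\to\infty}\gamma_{\theta,n}>0$. (c) There exists $\Theta_\epsilon^w\in\mathcal B(\Theta)$ with $\pi[\Theta_\epsilon^w]>0$ such that, for all sufficiently large $n\in\mathbb N^*$, every $y^{1:n}\in\mathcal Y^n$, and $\pi$-almost every $\theta\in\Theta_\epsilon^w$, $$w_\epsilon^n(\theta)\le\mu_\theta^n\big[D_{\epsilon^\star+\epsilon}(y^{1:n})\big].$$ (d) There exist $\delta\in[0,1)$ and $\Theta_\epsilon^\delta\in\mathcal B(\Theta)$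 with $\pi[\Theta_\epsilon^\delta]>0$ such that, for $\pi$-almost every $\theta\in\Theta_\epsilon^\delta$ and every $\lambda\in(0,1)$, $$\limsup_{n\to\infty}\mu_\theta^n\Big[\big\{y_\theta^{1:n}\in\mathcal Y_\theta^n:\ \mathcal T(\nu_{\theta,n},\nu_\theta)>\epsilon\lambda\big\}\Big]\le\delta .$$ Then, $\mathbf P$-almost surely (the observed samples being $y^{1:n}=y^{1:n}(\omega)$), $$\liminf_{n\to\infty}\pi^n_{\epsilon^\star+\epsilon}\Big[\big\{\theta\in\Theta_\epsilon\cap\Theta_\epsilon^w\cap\Theta_\epsilon^\delta:\ \mathcal T_\theta^\star>\epsilon^\star\big\}\Big]\ \ge\ (1-\delta)\,\pi\Big[\big\{\theta\in\Theta_\epsilon\cap\Theta_\epsilon^w\cap\Theta_\epsilon^\delta:\ \epsilon^\star<\mathcal T_\theta^\star\le\epsilon^\star+\epsilon\,\beta_\theta\big\}\Big].$$ In particular, whenever the set on the right-hand side has strictly positive $\pi$-mass, the left-hand side is strictly positive.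
   Context: Basic setting. $(\Omega,\mathcal A,\mathbf P)$ is a probability space; $\mathbb N^*=\{1,2,\dots\}$; $\mathbb R_+=[0,\infty)$. $\mathcal Y\subseteq\mathbb R^{m_{\mathcal Y}}$ (observation space) and $\Theta\subseteq\mathbb R^{m_\Theta}$ (parameter space) carry the topologies induced by metrics $d_{\mathcal Y}$, $d_\Theta$. For a topological space $X$, $\mathcal B(X)$ is its Borel $\sigma$-algebra and $\mathscr P(X)$ the set of probability measures on $\mathcal B(X)$. $\pi\in\mathscr P(\Theta)$ is the prior. For each $n\in\mathbb N^*$, $\{\mu_\theta^n\}_{\theta\in\Theta}\subseteq\mathscr P(\mathcal Y^n)$ is the statistical model. For each $n$, each $\omega\in\Omega$ determines an observed sample $y^{1:n}=y^{1:n}(\omega)\in\mathcal Y^n$. For $\pi$-a.e. $\theta$, $\mathcal Y_\theta^n\in\mathcal B(\mathcal Y^n)$ is a fixed set with $\mu_\theta^n[\mathcal Y_\theta^n]=1$; its elements are written $y_\theta^{1:n}$ (pseudo-samples). ABC posterior. For each $n$, $\mathcal D:\mathcal Y^n\times\mathcal Y^n\to\mathbb R_+$ is a continuous pseudo-metric, and $D_r(y^{1:n}):=\{\tilde y^{1:n}\in\mathcal Y^n:\mathcal D(y^{1:n},\tilde y^{1:n})\le r\}$. There is $\epsilon^\circ\in(0,\infty)$ such that for all $n$, all $y^{1:n}\in\mathcal Y^n$ and all $t\in(0,\epsilon^\circ)$ the map $\theta\mapsto\mu_\theta^n[D_t(y^{1:n})]$ is Borel measurable from $\Theta$ to $[0,1]$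 and not $\pi$-a.s. equal to zero. For such $t$ the ABC posterior is $$\pi_t^n[B]:=\frac{\int_B\mu_\theta^n[D_t(y^{1:n})]\,\pi(d\theta)}{\int_\Theta\mu_{\theta'}^n[D_t(y^{1:n})]\,\pi(d\theta')},\qquad B\in\mathcal B(\Theta).$$ Probabilistic representations. $\mathcal T:\mathscr P(\mathcal Y)\times\mathscr P(\mathcal Y)\to\mathbb R_+$ is a pseudo-metric. To each observed sample is associated $\nu_n=\nu_n(y^{1:n})\in\mathscr P(\mathcal Y)$, and, for $\pi$-a.e. $\theta$, to each pseudo-sample $y_\theta^{1:n}\in\mathcal Y_\theta^n$ is associated $\nu_{\theta,n}=\nu_{\theta,n}(y_\theta^{1:n})\in\mathscr P(\mathcal Y)$. For every $n$, every $y^{1:n}\in\mathcal Y^n$ and $\pi$-a.e. $\theta$, the map $y_\theta^{1:n}\mapsto\Delta_{\theta,n}(y_\theta^{1:n}):=\mathcal T(\nu_n(y^{1:n}),\nu_{\theta,n}(y_\theta^{1:n}))$ is Borel measurable on $\mathcal Y_\theta^n$. There is $\mu^\star\in\mathscr P(\mathcal Y)$ such that, for every $n$, $\omega\mapsto\mathcal T_n^\star:=\mathcal T(\mu^\star,\nu_n(y^{1:n}(\omega)))$ is $\mathcal A$-measurable, and $\mathcal T_n^\star\to0$ in $\mathbf P$-probability as $n\to\infty$. For $\pi$-a.e. $\theta$ there is $\nu_\theta\in\mathscr P(\mathcal Y)$ such that $\theta\mapsto\mathcal T_\theta^\star:=\mathcal T(\mu^\star,\nu_\theta)$ is a Borel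 function $\Theta\to\mathbb R_+$ and, for every $n$ and $\pi$-a.e. $\theta$, $y_\theta^{1:n}\mapsto\mathcal T(\nu_{\theta,n}(y_\theta^{1:n}),\nu_\theta)$ is Borel measurable on $\mathcal Y_\theta^n$. It is assumed that the $\pi$-essential infimum of $\theta\mapsto\mathcal T_\theta^\star$ equals its minimum, which is attained: $$\epsilon^\star:=\operatorname*{ess\,inf}_{\theta\in\Theta}\mathcal T_\theta^\star=\min_{\theta\in\Theta}\mathcal T_\theta^\star ,$$ and that $\epsilon^\star<\epsilon^\circ$. An admissible excess threshold is any $\epsilon\in(0,\epsilon^\circ-\epsilon^\star)$. Compatibility weights. For an excess threshold $\epsilon$, $$A_{\theta,n}(\epsilon):=\{y_\theta^{1:n}\in\mathcal Y_\theta^n:\Delta_{\theta,n}(y_\theta^{1:n})\le\epsilon^\star+\epsilon\},\qquad w_\epsilon^n(\theta):=\mu_\theta^n[A_{\theta,n}(\epsilon)]$$ (both depend on the observed sample $y^{1:n}$); $\theta\mapsto w_\epsilon^n(\theta)$ is assumed Borel measurable into $[0,1]$ and not $\pi$-a.s. zero. *)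

theory Defs
  imports "HOL-Probability.Probability"
begin

definition borel_of :: "'a topology \<Rightarrow> 'a measure" where
  "borel_of X = sigma (topspace X) {U. openin X U}"

definition prob_measures :: "'a topology \<Rightarrow> 'a measure set" where
  "prob_measures X = {M. sets M = sets (borel_of X) \<and> prob_space M}"

definition pseudo_metric_on :: "'a set \<Rightarrow> ('a \<Rightarrow> 'a \<Rightarrow> real) \<Rightarrow> bool" where
  "pseudo_metric_on X d \<longleftrightarrow>
     (\<forall>x\<in>X. d x x = 0) \<and>
     (\<forall>x\<in>X. \<forall>y\<in>X. 0 \<le> d x y \<and> d x y = d y x) \<and>
     (\<forall>x\<in>X. \<forall>y\<in>X. \<forall>z\<in>X. d x z \<le> d x y + d y z)"

definition essinf :: "'a measure \<Rightarrow> ('a \<Rightarrow> ereal) \<Rightarrow> ereal" where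
  "essinf M f = - esssup M (\<lambda>x. - f x)"

definition tendsto_in_prob :: "'w measure \<Rightarrow> (nat \<Rightarrow> 'w \<Rightarrow> real) \<Rightarrow> real \<Rightarrow> bool" where
  "tendsto_in_prob P X c \<longleftrightarrow>
     (\<forall>e>0. (\<lambda>n. measure P {\<omega> \<in> space P. \<bar>X n \<omega> - c\<bar> > e}) \<longlonglongrightarrow> 0)"

text \<open>\<open>f\<close> coincides, up to an \<open>M\<close>-null set, with a measurable map from \<open>A\<close> to the open unit interval.
  Sets defined through such an \<open>f\<close> need not belong to \<open>sets M\<close>, and are to be measured by
  \<open>completion M\<close>.\<close>

definition unit_measurable_mod_null :: "'a measure \<Rightarrow> 'a set \<Rightarrow> ('a \<Rightarrow> real) \<Rightarrow> bool" where
  "unit_measurable_mod_null M A f \<longleftrightarrow>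
     (\<exists>g \<in> measurable (restrict_space M A) (restrict_space borel {0<..<1}).
        AE x in M. x \<in> A \<longrightarrow> f x = g x)"

text \<open>Samples of size \<open>n\<close> are extensional functions on \<open>{1..n}\<close>, so that the \<open>n\<close>-th power of the
  observation space, for every \<open>n\<close>, is a set over one type. Its Borel sigma-algebra is that of the
  product topology, which may be larger than the product sigma-algebra if the metric is not
  separable.\<close>

definition sample_topology :: "'a set \<Rightarrow> ('a \<Rightarrow> 'a \<Rightarrow> real) \<Rightarrow> nat \<Rightarrow> (nat \<Rightarrow> 'a) topology" where
  "sample_topology Y d n = product_topology (\<lambda>_. Metric_space.mtopology Y d) {1..n}"

abbreviation samples :: "'a set \<Rightarrow> nat \<Rightarrow> (nat \<Rightarrow> 'a) set" where
  "samples Y n \<equiv> {1..n} \<rightarrow>\<^sub>E Y"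

definition disc_ball ::
  "'a set \<Rightarrow> (nat \<Rightarrow> (nat \<Rightarrow> 'a) \<Rightarrow> (nat \<Rightarrow> 'a) \<Rightarrow> real) \<Rightarrow> nat \<Rightarrow> real \<Rightarrow> (nat \<Rightarrow> 'a) \<Rightarrow> (nat \<Rightarrow> 'a) set" where
  "disc_ball Y D n r y = {z \<in> samples Y n. D n y z \<le> r}"

definition abc_posterior ::
  "'a set \<Rightarrow> (nat \<Rightarrow> (nat \<Rightarrow> 'a) \<Rightarrow> (nat \<Rightarrow> 'a) \<Rightarrow> real) \<Rightarrow> (nat \<Rightarrow> 'p \<Rightarrow> (nat \<Rightarrow> 'a) measure) \<Rightarrow>
   'p measure \<Rightarrow> nat \<Rightarrow> real \<Rightarrow> (nat \<Rightarrow> 'a) \<Rightarrow> 'p set \<Rightarrow> real" where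
  "abc_posterior Y D \<mu> \<pi> n t y B =
     (LINT \<theta>:B|\<pi>. measure (\<mu> n \<theta>) (disc_ball Y D n t y)) /
     (LINT \<theta>|\<pi>. measure (\<mu> n \<theta>) (disc_ball Y D n t y))"

definition compat_set ::
  "(nat \<Rightarrow> 'p \<Rightarrow> (nat \<Rightarrow> 'a) set) \<Rightarrow> ('a measure \<Rightarrow> 'a measure \<Rightarrow> real) \<Rightarrow>
   (nat \<Rightarrow> (nat \<Rightarrow> 'a) \<Rightarrow> 'a measure) \<Rightarrow> (nat \<Rightarrow> 'p \<Rightarrow> (nat \<Rightarrow> 'a) \<Rightarrow> 'a measure) \<Rightarrow>
   real \<Rightarrow> real \<Rightarrow> nat \<Rightarrow> (nat \<Rightarrow> 'a) \<Rightarrow> 'p \<Rightarrow> (nat \<Rightarrow> 'a) set" where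
  "compat_set YS T \<nu>obs \<nu>sim \<epsilon>star \<epsilon> n y \<theta> =
     {z \<in> YS n \<theta>. T (\<nu>obs n y) (\<nu>sim n \<theta> z) \<le> \<epsilon>star + \<epsilon>}"

definition compat_weight ::
  "(nat \<Rightarrow> 'p \<Rightarrow> (nat \<Rightarrow> 'a) measure) \<Rightarrow> (nat \<Rightarrow> 'p \<Rightarrow> (nat \<Rightarrow> 'a) set) \<Rightarrow>
   ('a measure \<Rightarrow> 'a measure \<Rightarrow> real) \<Rightarrow>
   (nat \<Rightarrow> (nat \<Rightarrow> 'a) \<Rightarrow> 'a measure) \<Rightarrow> (nat \<Rightarrow> 'p \<Rightarrow> (nat \<Rightarrow> 'a) \<Rightarrow> 'a measure) \<Rightarrow>
   real \<Rightarrow> real \<Rightarrow> nat \<Rightarrow> (nat \<Rightarrow> 'a) \<Rightarrow> 'p \<Rightarrow> real" where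
  "compat_weight \<mu> YS T \<nu>obs \<nu>sim \<epsilon>star \<epsilon> n y \<theta> =
     measure (\<mu> n \<theta>) (compat_set YS T \<nu>obs \<nu>sim \<epsilon>star \<epsilon> n y \<theta>)"

text \<open>\<open>obs n \<omega>\<close> is the observed sample of size \<open>n\<close>, \<open>YS n \<theta>\<close> the set of pseudo-samples of full
  \<open>\<mu> n \<theta>\<close>-measure, and \<open>\<nu>obs\<close>, \<open>\<nu>sim\<close>, \<open>\<nu>lim\<close> are the representations of observed samples, of
  pseudo-samples, and of parameters. Objects that exist only for almost every \<open>\<theta>\<close>
  (\<open>YS\<close>, \<open>\<nu>sim\<close>, \<open>\<nu>lim\<close>) are total functions, unconstrained on the exceptional null set, apart from
  \<open>T \<mu>star (\<nu>lim \<theta>)\<close>, which has to be a nonnegative Borel function on all of \<open>\<Theta>\<close>.\<close>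

locale abc_model =
  fixes P :: "'w measure"
    and Y :: "(real ^ 'm) set" and dY :: "real ^ 'm \<Rightarrow> real ^ 'm \<Rightarrow> real"
    and \<Theta> :: "(real ^ 'k) set" and d\<Theta> :: "real ^ 'k \<Rightarrow> real ^ 'k \<Rightarrow> real"
    and \<pi> :: "(real ^ 'k) measure"
    and \<mu> :: "nat \<Rightarrow> real ^ 'k \<Rightarrow> (nat \<Rightarrow> real ^ 'm) measure"
    and obs :: "nat \<Rightarrow> 'w \<Rightarrow> (nat \<Rightarrow> real ^ 'm)"
    and YS :: "nat \<Rightarrow> real ^ 'k \<Rightarrow> (nat \<Rightarrow> real ^ 'm) set"
    and D :: "nat \<Rightarrow> (nat \<Rightarrow> real ^ 'm) \<Rightarrow> (nat \<Rightarrow> real ^ 'm) \<Rightarrow> real"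
    and \<epsilon>circ :: real
    and T :: "(real ^ 'm) measure \<Rightarrow> (real ^ 'm) measure \<Rightarrow> real"
    and \<nu>obs :: "nat \<Rightarrow> (nat \<Rightarrow> real ^ 'm) \<Rightarrow> (real ^ 'm) measure"
    and \<nu>sim :: "nat \<Rightarrow> real ^ 'k \<Rightarrow> (nat \<Rightarrow> real ^ 'm) \<Rightarrow> (real ^ 'm) measure"
    and \<mu>star :: "(real ^ 'm) measure"
    and \<nu>lim :: "real ^ 'k \<Rightarrow> (real ^ 'm) measure"
    and \<epsilon>star :: real
  assumes prob_P: "prob_space P"
    and metric_Y: "Metric_space Y dY"
    and metric_\<Theta>: "Metric_space \<Theta> d\<Theta>"
    and prior: "\<pi> \<in> prob_measures (Metric_space.mtopology \<Theta> d\<Theta>)"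
    and model: "\<And>n \<theta>. n \<ge> 1 \<Longrightarrow> \<theta> \<in> \<Theta> \<Longrightarrow> \<mu> n \<theta> \<in> prob_measures (sample_topology Y dY n)"
    and obs: "\<And>n \<omega>. n \<ge> 1 \<Longrightarrow> \<omega> \<in> space P \<Longrightarrow> obs n \<omega> \<in> samples Y n"
    and pseudo_samples: "\<And>n. n \<ge> 1 \<Longrightarrow>
      AE \<theta> in \<pi>. YS n \<theta> \<in> sets (borel_of (sample_topology Y dY n)) \<and> measure (\<mu> n \<theta>) (YS n \<theta>) = 1"
    and D_pseudo_metric: "\<And>n. n \<ge> 1 \<Longrightarrow> pseudo_metric_on (samples Y n) (D n)"
    and D_continuous: "\<And>n. n \<ge> 1 \<Longrightarrow>
      continuous_map (prod_topology (sample_topology Y dY n) (sample_topology Y dY n)) euclideanreal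
        (\<lambda>(y, z). D n y z)"
    and \<epsilon>circ_pos: "\<epsilon>circ > 0"
    and ball_measurable: "\<And>n y t. n \<ge> 1 \<Longrightarrow> y \<in> samples Y n \<Longrightarrow> 0 < t \<Longrightarrow> t < \<epsilon>circ \<Longrightarrow>
      (\<lambda>\<theta>. measure (\<mu> n \<theta>) (disc_ball Y D n t y))
        \<in> borel_measurable (borel_of (Metric_space.mtopology \<Theta> d\<Theta>))"
    and ball_nonzero: "\<And>n y t. n \<ge> 1 \<Longrightarrow> y \<in> samples Y n \<Longrightarrow> 0 < t \<Longrightarrow> t < \<epsilon>circ \<Longrightarrow>
      \<not> (AE \<theta> in \<pi>. measure (\<mu> n \<theta>) (disc_ball Y D n t y) = 0)"
    and T_pseudo_metric: "pseudo_metric_on (prob_measures (Metric_space.mtopology Y dY)) T"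
    and \<nu>obs_prob: "\<And>n y. n \<ge> 1 \<Longrightarrow> y \<in> samples Y n \<Longrightarrow>
      \<nu>obs n y \<in> prob_measures (Metric_space.mtopology Y dY)"
    and \<nu>sim_prob: "\<And>n. n \<ge> 1 \<Longrightarrow>
      AE \<theta> in \<pi>. \<forall>z\<in>YS n \<theta>. \<nu>sim n \<theta> z \<in> prob_measures (Metric_space.mtopology Y dY)"
    and \<Delta>_measurable: "\<And>n y. n \<ge> 1 \<Longrightarrow> y \<in> samples Y n \<Longrightarrow>
      AE \<theta> in \<pi>. (\<lambda>z. T (\<nu>obs n y) (\<nu>sim n \<theta> z))
        \<in> borel_measurable (restrict_space (borel_of (sample_topology Y dY n)) (YS n \<theta>))"
    and \<mu>star_prob: "\<mu>star \<in> prob_measures (Metric_space.mtopology Y dY)"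
    and Tn_measurable: "\<And>n. n \<ge> 1 \<Longrightarrow> (\<lambda>\<omega>. T \<mu>star (\<nu>obs n (obs n \<omega>))) \<in> borel_measurable P"
    and Tn_tendsto: "tendsto_in_prob P (\<lambda>n \<omega>. T \<mu>star (\<nu>obs n (obs n \<omega>))) 0"
    and \<nu>lim_prob: "AE \<theta> in \<pi>. \<nu>lim \<theta> \<in> prob_measures (Metric_space.mtopology Y dY)"
    and T\<theta>_measurable: "(\<lambda>\<theta>. T \<mu>star (\<nu>lim \<theta>))
        \<in> borel_measurable (borel_of (Metric_space.mtopology \<Theta> d\<Theta>))"
    and T\<theta>_nonneg: "\<And>\<theta>. \<theta> \<in> \<Theta> \<Longrightarrow> 0 \<le> T \<mu>star (\<nu>lim \<theta>)"
    and T\<theta>n_measurable: "\<And>n. n \<ge> 1 \<Longrightarrow>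
      AE \<theta> in \<pi>. (\<lambda>z. T (\<nu>sim n \<theta> z) (\<nu>lim \<theta>))
        \<in> borel_measurable (restrict_space (borel_of (sample_topology Y dY n)) (YS n \<theta>))"
    and \<epsilon>star_essinf: "ereal \<epsilon>star = essinf \<pi> (\<lambda>\<theta>. ereal (T \<mu>star (\<nu>lim \<theta>)))"
    and \<epsilon>star_attained: "\<exists>\<theta>\<in>\<Theta>. T \<mu>star (\<nu>lim \<theta>) = \<epsilon>star"
    and \<epsilon>star_min: "\<And>\<theta>. \<theta> \<in> \<Theta> \<Longrightarrow> \<epsilon>star \<le> T \<mu>star (\<nu>lim \<theta>)"
    and \<epsilon>star_less: "\<epsilon>star < \<epsilon>circ"

end

theory Submission
  imports Defs
begin

text \<open>The normalising constant of the ABC posterior is at most one, so it suffices to bound the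
  numerator from below. On the almost sure event of (a), the triangle inequality through \<open>\<mu>star\<close> and
  \<open>\<nu>lim \<theta>\<close> shows that a pseudo-sample with \<open>T (\<nu>sim n \<theta> z) (\<nu>lim \<theta>) \<le> \<epsilon> * \<gamma> \<theta> n\<close> is compatible. Since
  \<open>\<gamma> \<theta> n\<close> is eventually above a positive constant, (d) yields that the lower limit of the weights is at
  least \<open>1 - \<delta>\<close> for almost every \<open>\<theta>\<close>; (c) and Fatou's lemma conclude.\<close>

section \<open>Lower limits of real sequences and Fatou's lemma\<close>

lemma ereal_le_liminf_iff:
  fixes a :: "nat \<Rightarrow> real"
  shows "ereal c \<le> liminf (\<lambda>n. ereal (a n)) \<longleftrightarrow> (\<forall>r<c. \<forall>\<^sub>F n in sequentially. r < a n)"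
proof
  assume "ereal c \<le> liminf (\<lambda>n. ereal (a n))"
  then show "\<forall>r<c. \<forall>\<^sub>F n in sequentially. r < a n"
    unfolding le_Liminf_iff by (metis (no_types, lifting) eventually_mono less_ereal.simps(1))
next
  assume r: "\<forall>r<c. \<forall>\<^sub>F n in sequentially. r < a n"
  show "ereal c \<le> liminf (\<lambda>n. ereal (a n))"
    unfolding le_Liminf_iff
  proof (intro allI impI)
    fix y assume "y < ereal c"
    then show "\<forall>\<^sub>F n in sequentially. y < ereal (a n)"
    proof (cases y)
      case (real q)
      with \<open>y < ereal c\<close> r have "\<forall>\<^sub>F n in sequentially. q < a n" by simp
      with real show ?thesis by simp
    qed simp_all
  qed
qed

text \<open>If r < 1 - \<delta>, the upper limit of \<open>e\<close> lies strictly below 1 - r, so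
  eventually \<open>e n\<close> < 1 - r and \<open>a n\<close> > r. This turns the upper bound (d)
  on the mass of badly concentrated pseudo-samples into a lower bound on weights.\<close>

lemma one_minus_le_liminf:
  fixes a e :: "nat \<Rightarrow> real"
  assumes "limsup (\<lambda>n. ereal (e n)) \<le> ereal \<delta>"
    and ge: "\<forall>\<^sub>F n in sequentially. 1 - e n \<le> a n"
  shows "ereal (1 - \<delta>) \<le> liminf (\<lambda>n. ereal (a n))"
  unfolding ereal_le_liminf_iff
proof (intro allI impI)
  fix r assume "r < 1 - \<delta>"
  then have "ereal \<delta> < ereal (1 - r)" by simp
  with assms(1) have "limsup (\<lambda>n. ereal (e n)) < ereal (1 - r)"
    by (rule le_less_trans)
  then have "\<forall>\<^sub>F n in sequentially. ereal (e n) < ereal (1 - r)"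
    by (rule Limsup_lessD)
  then show "\<forall>\<^sub>F n in sequentially. r < a n"
    using ge by eventually_elim simp
qed

text \<open>Bridge between Fatou's lemma, which lives in \<open>ennreal\<close>, and lower limits in
  \<open>ereal\<close>. Thresholds below zero, which exist only on the \<open>ereal\<close> side,
  are passed trivially by a nonnegative sequence; this also covers negative \<open>c\<close>, where
  \<open>ennreal c\<close> is 0.\<close>

lemma ennreal_le_liminf_iff:
  fixes a :: "nat \<Rightarrow> real"
  assumes "\<And>n. 0 \<le> a n"
  shows "ennreal c \<le> liminf (\<lambda>n. ennreal (a n)) \<longleftrightarrow> ereal c \<le> liminf (\<lambda>n. ereal (a n))"
  unfolding ereal_le_liminf_iff unfolding le_Liminf_iff
proof (intro iffI allI impI)
  fix r assume *: "\<forall>y<ennreal c. \<forall>\<^sub>F n in sequentially. y < ennreal (a n)" and "r < c"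
  show "\<forall>\<^sub>F n in sequentially. r < a n"
  proof (cases "0 \<le> r")
    case True
    then have "ennreal r < ennreal c" using \<open>r < c\<close> by (simp add: ennreal_less_iff)
    with * have "\<forall>\<^sub>F n in sequentially. ennreal r < ennreal (a n)" by blast
    then show ?thesis using True by (simp add: ennreal_less_iff)
  next
    case False
    then have "r < a n" for n using assms[of n] by linarith
    then show ?thesis by simp
  qed
next
  fix y assume *: "\<forall>r<c. \<forall>\<^sub>F n in sequentially. r < a n" and y: "y < ennreal c"
  then obtain r where r: "0 \<le> r" "y = ennreal r" by (cases y) auto
  then have "r < c" using y by (simp add: ennreal_less_iff)
  with * have "\<forall>\<^sub>F n in sequentially. r < a n" by blast
  then show "\<forall>\<^sub>F n in sequentially. y < ennreal (a n)"
    using r by (simp add: ennreal_less_iff)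
qed

text \<open>Fatou's lemma for the functions \<open>f n\<close> cut off outside \<open>B\<close>: on
  \<open>B\<close> the lower limit is at least \<open>c\<close> almost everywhere, so its integral
  is at least \<open>c\<close> times the mass of \<open>B\<close>.\<close>

lemma (in finite_measure) liminf_set_integral_ge:
  fixes f :: "nat \<Rightarrow> 'a \<Rightarrow> real"
  assumes f: "\<And>n. f n \<in> borel_measurable M"
    and nonneg: "\<And>n x. 0 \<le> f n x" and le: "\<And>n x. f n x \<le> b"
    and B: "B \<in> sets M" and c: "0 \<le> c"
    and lim: "AE x in M. x \<in> B \<longrightarrow> ereal c \<le> liminf (\<lambda>n. ereal (f n x))"
  shows "ereal (c * measure M B) \<le> liminf (\<lambda>n. ereal (LINT x:B|M. f n x))"
proof -
  \<comment> \<open>The uniform bound on a finite measure gives integrability, without which the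
    real-valued integral could not be identified with the nonnegative one that Fatou's lemma
    concerns.\<close>
  have int: "integrable M (\<lambda>x. indicator B x * f n x)" for n
  proof (rule integrable_const_bound[where B=b])
    have "\<bar>indicator B x * f n x\<bar> \<le> b" for x
      using nonneg[of n x] le[of n x] by (auto simp: indicator_def)
    then show "AE x in M. norm (indicator B x * f n x) \<le> b" by simp
  qed (use f B in measurable)
  have eq: "ennreal (LINT x:B|M. f n x) = (\<integral>\<^sup>+x. ennreal (indicator B x * f n x) \<partial>M)" for n
    unfolding set_lebesgue_integral_def
    using nn_integral_eq_integral[OF int[of n]] nonneg by simp
  have "ennreal (c * measure M B) = (\<integral>\<^sup>+x. ennreal c * indicator B x \<partial>M)"
    using B c by (simp add: nn_integral_cmult_indicator emeasure_eq_measure ennreal_mult)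
  also have "\<dots> \<le> (\<integral>\<^sup>+x. liminf (\<lambda>n. ennreal (indicator B x * f n x)) \<partial>M)"
  proof (rule nn_integral_mono_AE, use lim in eventually_elim)
    case (elim x)
    then show ?case
      using nonneg ennreal_le_liminf_iff[of "\<lambda>n. f n x" c] by (auto simp: indicator_def)
  qed
  also have "\<dots> \<le> liminf (\<lambda>n. \<integral>\<^sup>+x. ennreal (indicator B x * f n x) \<partial>M)"
    by (rule nn_integral_liminf) (use f B in measurable)
  finally have "ennreal (c * measure M B) \<le> liminf (\<lambda>n. ennreal (LINT x:B|M. f n x))"
    by (simp add: eq)
  then show ?thesis
    by (subst (asm) ennreal_le_liminf_iff) (auto simp: set_lebesgue_integral_def nonneg)
qed

section \<open>Borel sigma-algebras of topologies and measurability of sublevel sets\<close>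

lemma space_borel_of: "space (borel_of X) = topspace X"
  unfolding borel_of_def by (rule space_measure_of) (auto dest: openin_subset)

lemma space_prob_measures: "M \<in> prob_measures X \<Longrightarrow> space M = topspace X"
  using sets_eq_imp_space_eq[of M "borel_of X"] by (simp add: prob_measures_def space_borel_of)

lemma measurable_prob_measures:
  assumes "M \<in> prob_measures X" "f \<in> measurable (borel_of X) N"
  shows "f \<in> measurable M N"
  using assms(2) measurable_cong_sets[OF _ refl, of M "borel_of X" N] assms(1)
  unfolding prob_measures_def by blast

text \<open>Since \<open>A\<close> itself is in \<open>sets M\<close>, the trace sigma-algebra on
  \<open>A\<close> consists of sets of \<open>M\<close>. Measurability on
  \<open>YS n \<theta>\<close>, as granted by the model, thus yields events for
  \<open>\<mu> n \<theta>\<close>.\<close>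

lemma sets_restrict_borel_le:
  fixes f :: "'a \<Rightarrow> real"
  assumes "f \<in> borel_measurable (restrict_space M A)" "A \<in> sets M"
  shows "{x \<in> A. f x \<le> r} \<in> sets M"
proof -
  have "{x \<in> space (restrict_space M A). f x \<le> r} \<in> sets (restrict_space M A)"
    using assms(1) by measurable
  moreover have "space (restrict_space M A) = A"
    using assms(2) sets.sets_into_space by (auto simp: space_restrict_space)
  ultimately show ?thesis
    using assms(2) by (simp add: sets_restrict_space_iff)
qed

section \<open>Bounds for a fixed sample size\<close>

context abc_model
begin

lemma prob_prior: "prob_space \<pi>"
  and sets_prior: "sets \<pi> = sets (borel_of (Metric_space.mtopology \<Theta> d\<Theta>))"
  and space_prior: "space \<pi> = \<Theta>"
  using prior space_prob_measures[OF prior] Metric_space.topspace_mtopology[OF metric_\<Theta>]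
  by (auto simp: prob_measures_def)

lemma \<epsilon>star_nonneg: "0 \<le> \<epsilon>star"
  using \<epsilon>star_attained T\<theta>_nonneg by metis

text \<open>The path from the observed representation through \<open>\<mu>star\<close> and
  \<open>\<nu>lim \<theta>\<close> to the simulated one has three legs, and \<open>le\<close> says
  that they fit into the threshold once the last leg is at most \<open>r\<close>. The
  almost-everywhere properties are assumed at this single \<theta>, so that null sets are dealt with
  by the caller.\<close>

lemma compat_weight_ge:
  assumes n: "n \<ge> 1" and y: "y \<in> samples Y n" and \<theta>: "\<theta> \<in> \<Theta>"
    and YS: "YS n \<theta> \<in> sets (borel_of (sample_topology Y dY n))" "measure (\<mu> n \<theta>) (YS n \<theta>) = 1"
    and sim: "\<forall>z\<in>YS n \<theta>. \<nu>sim n \<theta> z \<in> prob_measures (Metric_space.mtopology Y dY)"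
    and lim: "\<nu>lim \<theta> \<in> prob_measures (Metric_space.mtopology Y dY)"
    and \<Delta>: "(\<lambda>z. T (\<nu>obs n y) (\<nu>sim n \<theta> z))
        \<in> borel_measurable (restrict_space (borel_of (sample_topology Y dY n)) (YS n \<theta>))"
    and conc: "(\<lambda>z. T (\<nu>sim n \<theta> z) (\<nu>lim \<theta>))
        \<in> borel_measurable (restrict_space (borel_of (sample_topology Y dY n)) (YS n \<theta>))"
    and le: "T \<mu>star (\<nu>obs n y) + T \<mu>star (\<nu>lim \<theta>) + r \<le> \<epsilon>star + \<epsilon>"
  shows "1 - measure (\<mu> n \<theta>) {z \<in> YS n \<theta>. T (\<nu>sim n \<theta> z) (\<nu>lim \<theta>) > r}
    \<le> compat_weight \<mu> YS T \<nu>obs \<nu>sim \<epsilon>star \<epsilon> n y \<theta>"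
proof -
  interpret \<mu>: prob_space "\<mu> n \<theta>"
    using model[OF n \<theta>] by (simp add: prob_measures_def)
  have sets: "sets (\<mu> n \<theta>) = sets (borel_of (sample_topology Y dY n))"
    using model[OF n \<theta>] by (simp add: prob_measures_def)
  let ?E = "{z \<in> YS n \<theta>. T (\<nu>sim n \<theta> z) (\<nu>lim \<theta>) \<le> r}"
  let ?C = "compat_set YS T \<nu>obs \<nu>sim \<epsilon>star \<epsilon> n y \<theta>"
  have E: "?E \<in> sets (\<mu> n \<theta>)" and C: "?C \<in> sets (\<mu> n \<theta>)"
    unfolding sets compat_set_def
    using sets_restrict_borel_le[OF conc YS(1)] sets_restrict_borel_le[OF \<Delta> YS(1)] by auto
  \<comment> \<open>As \<open>YS n \<theta>\<close> has full mass, the complement of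
    \<open>?E\<close> can be taken inside it.\<close>
  have "{z \<in> YS n \<theta>. T (\<nu>sim n \<theta> z) (\<nu>lim \<theta>) > r} = YS n \<theta> - ?E" by auto
  then have "1 - measure (\<mu> n \<theta>) {z \<in> YS n \<theta>. T (\<nu>sim n \<theta> z) (\<nu>lim \<theta>) > r} = measure (\<mu> n \<theta>) ?E"
    using \<mu>.finite_measure_Diff[of "YS n \<theta>" ?E] YS E sets by auto
  also have "?E \<subseteq> ?C"
  proof
    fix z assume z: "z \<in> ?E"
    let ?M = "prob_measures (Metric_space.mtopology Y dY)"
    have tri: "\<And>p q s. p \<in> ?M \<Longrightarrow> q \<in> ?M \<Longrightarrow> s \<in> ?M \<Longrightarrow> T p s \<le> T p q + T q s"
      and symm: "\<And>p q. p \<in> ?M \<Longrightarrow> q \<in> ?M \<Longrightarrow> T p q = T q p"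
      using T_pseudo_metric unfolding pseudo_metric_on_def by blast+
    have obs: "\<nu>obs n y \<in> ?M" and z': "\<nu>sim n \<theta> z \<in> ?M"
      using \<nu>obs_prob[OF n y] sim z by auto
    have "T (\<nu>obs n y) (\<nu>sim n \<theta> z) \<le> T (\<nu>obs n y) \<mu>star + T \<mu>star (\<nu>sim n \<theta> z)"
      by (rule tri[OF obs \<mu>star_prob z'])
    also have "T \<mu>star (\<nu>sim n \<theta> z) \<le> T \<mu>star (\<nu>lim \<theta>) + T (\<nu>lim \<theta>) (\<nu>sim n \<theta> z)"
      by (rule tri[OF \<mu>star_prob lim z'])
    finally show "z \<in> ?C"
      using z le symm[OF obs \<mu>star_prob] symm[OF lim z'] by (auto simp: compat_set_def)
  qed
  then have "measure (\<mu> n \<theta>) ?E \<le> measure (\<mu> n \<theta>) ?C"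
    by (rule \<mu>.finite_measure_mono[OF _ C])
  finally show ?thesis by (simp add: compat_weight_def)
qed

text \<open>Dividing a nonnegative number by one in (0,1] does not decrease it. The normalising
  integral is at most 1 because it averages probabilities over the prior, and positive because
  \<open>ball_nonzero\<close> forbids an integrand that vanishes almost everywhere.\<close>

lemma abc_posterior_ge:
  assumes n: "n \<ge> 1" and y: "y \<in> samples Y n" and t: "0 < t" "t < \<epsilon>circ"
  shows "(LINT \<theta>:B|\<pi>. measure (\<mu> n \<theta>) (disc_ball Y D n t y)) \<le> abc_posterior Y D \<mu> \<pi> n t y B"
proof -
  interpret \<pi>: prob_space \<pi> by (rule prob_prior)
  let ?f = "\<lambda>\<theta>. measure (\<mu> n \<theta>) (disc_ball Y D n t y)"
  have f: "?f \<in> borel_measurable \<pi>"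
    by (rule measurable_prob_measures[OF prior ball_measurable[OF n y t]])
  have bound: "?f \<theta> \<le> 1" if "\<theta> \<in> \<Theta>" for \<theta>
    using model[OF n that] by (simp add: prob_measures_def prob_space.prob_le_1)
  have int: "integrable \<pi> ?f"
    by (rule \<pi>.integrable_const_bound[where B=1])
      (use f bound in \<open>auto simp: space_prior intro!: AE_I2\<close>)
  have "(LINT \<theta>|\<pi>. ?f \<theta>) \<le> (LINT \<theta>|\<pi>. 1)"
    by (rule integral_mono[OF int]) (use bound space_prior in auto)
  then have le1: "(LINT \<theta>|\<pi>. ?f \<theta>) \<le> 1"
    by (simp add: \<pi>.prob_space)
  have "(LINT \<theta>|\<pi>. ?f \<theta>) \<noteq> 0"
    using ball_nonzero[OF n y t] by (subst integral_nonneg_eq_0_iff_AE[OF int]) simp_all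
  moreover have "0 \<le> (LINT \<theta>|\<pi>. ?f \<theta>)"
    by (rule Bochner_Integration.integral_nonneg) simp
  ultimately have pos: "0 < (LINT \<theta>|\<pi>. ?f \<theta>)" by linarith
  have "0 \<le> (LINT \<theta>:B|\<pi>. ?f \<theta>)"
    by (simp add: set_lebesgue_integral_def)
  then show ?thesis
    unfolding abc_posterior_def by (subst pos_le_divide_eq[OF pos]) (rule mult_left_le[OF le1])
qed

end

section \<open>The asymptotic lower bound for the ABC posterior\<close>

theorem theorem3p1:
  fixes P :: "'w measure"
    and Y :: "(real ^ 'm) set" and dY :: "real ^ 'm \<Rightarrow> real ^ 'm \<Rightarrow> real"
    and \<Theta> :: "(real ^ 'k) set" and d\<Theta> :: "real ^ 'k \<Rightarrow> real ^ 'k \<Rightarrow> real"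
    and \<alpha> :: "nat \<Rightarrow> real" and \<beta> :: "real ^ 'k \<Rightarrow> real" and \<gamma> :: "real ^ 'k \<Rightarrow> nat \<Rightarrow> real"
    and \<epsilon> \<epsilon>star \<epsilon>circ \<delta> :: real
    and \<Theta>\<epsilon> \<Theta>w \<Theta>\<delta> :: "(real ^ 'k) set"
  assumes setting: "abc_model P Y dY \<Theta> d\<Theta> \<pi> \<mu> obs YS D \<epsilon>circ T \<nu>obs \<nu>sim \<mu>star \<nu>lim \<epsilon>star"
    and admissible: "\<epsilon> \<in> {0<..<\<epsilon>circ - \<epsilon>star}"
    and weight_measurable: "\<And>n y. n \<ge> 1 \<Longrightarrow> y \<in> samples Y n \<Longrightarrow>
      (\<lambda>\<theta>. compat_weight \<mu> YS T \<nu>obs \<nu>sim \<epsilon>star \<epsilon> n y \<theta>)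
        \<in> borel_measurable (borel_of (Metric_space.mtopology \<Theta> d\<Theta>))"
    and weight_nonzero: "\<And>n y. n \<ge> 1 \<Longrightarrow> y \<in> samples Y n \<Longrightarrow>
      \<not> (AE \<theta> in \<pi>. compat_weight \<mu> YS T \<nu>obs \<nu>sim \<epsilon>star \<epsilon> n y \<theta> = 0)"
    and a_set: "\<Theta>\<epsilon> \<in> sets (borel_of (Metric_space.mtopology \<Theta> d\<Theta>))" "measure \<pi> \<Theta>\<epsilon> > 0"
    and a_beta: "unit_measurable_mod_null \<pi> \<Theta>\<epsilon> \<beta>"
    and a_gamma: "\<forall>\<^sub>F n in sequentially. unit_measurable_mod_null \<pi> \<Theta>\<epsilon> (\<lambda>\<theta>. \<gamma> \<theta> n)"
    and a_coeffs: "\<forall>\<^sub>F n in sequentially. AE \<theta> in \<pi>. \<theta> \<in> \<Theta>\<epsilon> \<longrightarrow>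
      \<alpha> n \<in> {0<..<1} \<and> \<beta> \<theta> \<in> {0<..<1} \<and> \<gamma> \<theta> n \<in> {0<..<1} \<and> \<alpha> n + \<beta> \<theta> + \<gamma> \<theta> n \<le> 1"
    and a_obs: "\<forall>\<^sub>F n in sequentially. AE \<omega> in P. T \<mu>star (\<nu>obs n (obs n \<omega>)) \<le> \<epsilon> * \<alpha> n"
    and a_param: "AE \<theta> in \<pi>. \<theta> \<in> \<Theta>\<epsilon> \<longrightarrow> T \<mu>star (\<nu>lim \<theta>) \<le> \<epsilon>star + \<epsilon> * \<beta> \<theta>"
    and b: "AE \<theta> in \<pi>. \<theta> \<in> \<Theta>\<epsilon> \<longrightarrow> liminf (\<lambda>n. ereal (\<gamma> \<theta> n)) > 0"
    and c_set: "\<Theta>w \<in> sets (borel_of (Metric_space.mtopology \<Theta> d\<Theta>))" "measure \<pi> \<Theta>w > 0"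
    and c: "\<forall>\<^sub>F n in sequentially. \<forall>y\<in>samples Y n. AE \<theta> in \<pi>. \<theta> \<in> \<Theta>w \<longrightarrow>
      compat_weight \<mu> YS T \<nu>obs \<nu>sim \<epsilon>star \<epsilon> n y \<theta>
        \<le> measure (\<mu> n \<theta>) (disc_ball Y D n (\<epsilon>star + \<epsilon>) y)"
    and d_delta: "0 \<le> \<delta>" "\<delta> < 1"
    and d_set: "\<Theta>\<delta> \<in> sets (borel_of (Metric_space.mtopology \<Theta> d\<Theta>))" "measure \<pi> \<Theta>\<delta> > 0"
    and d: "AE \<theta> in \<pi>. \<theta> \<in> \<Theta>\<delta> \<longrightarrow> (\<forall>l\<in>{0<..<1}.
      limsup (\<lambda>n. ereal (measure (\<mu> n \<theta>) {z \<in> YS n \<theta>. T (\<nu>sim n \<theta> z) (\<nu>lim \<theta>) > \<epsilon> * l}))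
        \<le> ereal \<delta>)"
  shows "AE \<omega> in P.
      liminf (\<lambda>n. ereal (abc_posterior Y D \<mu> \<pi> n (\<epsilon>star + \<epsilon>) (obs n \<omega>)
          {\<theta> \<in> \<Theta>\<epsilon> \<inter> \<Theta>w \<inter> \<Theta>\<delta>. T \<mu>star (\<nu>lim \<theta>) > \<epsilon>star}))
        \<ge> ereal ((1 - \<delta>) * measure (completion \<pi>)
          {\<theta> \<in> \<Theta>\<epsilon> \<inter> \<Theta>w \<inter> \<Theta>\<delta>. \<epsilon>star < T \<mu>star (\<nu>lim \<theta>) \<and> T \<mu>star (\<nu>lim \<theta>) \<le> \<epsilon>star + \<epsilon> * \<beta> \<theta>})
      \<and> (measure (completion \<pi>)
          {\<theta> \<in> \<Theta>\<epsilon> \<inter> \<Theta>w \<inter> \<Theta>\<delta>. \<epsilon>star < T \<mu>star (\<nu>lim \<theta>) \<and> T \<mu>star (\<nu>lim \<theta>) \<le> \<epsilon>star + \<epsilon> * \<beta> \<theta>} > 0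
        \<longrightarrow> liminf (\<lambda>n. ereal (abc_posterior Y D \<mu> \<pi> n (\<epsilon>star + \<epsilon>) (obs n \<omega>)
          {\<theta> \<in> \<Theta>\<epsilon> \<inter> \<Theta>w \<inter> \<Theta>\<delta>. T \<mu>star (\<nu>lim \<theta>) > \<epsilon>star})) > 0)"
proof -
  interpret abc_model P Y dY \<Theta> d\<Theta> \<pi> \<mu> obs YS D \<epsilon>circ T \<nu>obs \<nu>sim \<mu>star \<nu>lim \<epsilon>star
    by (rule setting)
  interpret \<pi>: prob_space \<pi> by (rule prob_prior)
  define t where "t = \<epsilon>star + \<epsilon>"
  have t: "0 < t" "t < \<epsilon>circ" and \<epsilon>: "0 < \<epsilon>"
    using admissible \<epsilon>star_nonneg by (auto simp: t_def)
  define I where "I = \<Theta>\<epsilon> \<inter> \<Theta>w \<inter> \<Theta>\<delta>"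
  define B where "B = {\<theta> \<in> I. T \<mu>star (\<nu>lim \<theta>) > \<epsilon>star}"
  define S where "S = {\<theta> \<in> I. \<epsilon>star < T \<mu>star (\<nu>lim \<theta>) \<and> T \<mu>star (\<nu>lim \<theta>) \<le> \<epsilon>star + \<epsilon> * \<beta> \<theta>}"
  have I: "I \<in> sets \<pi>"
    using a_set(1) c_set(1) d_set(1) by (auto simp: I_def sets_prior)
  have [measurable]: "(\<lambda>\<theta>. T \<mu>star (\<nu>lim \<theta>)) \<in> borel_measurable \<pi>"
    by (rule measurable_prob_measures[OF prior T\<theta>_measurable])
  have "B = {\<theta> \<in> space \<pi>. T \<mu>star (\<nu>lim \<theta>) > \<epsilon>star} \<inter> I"
    using sets.sets_into_space[OF I] by (auto simp: B_def)
  then have B: "B \<in> sets \<pi>" using I by simp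
  \<comment> \<open>It suffices to prove the bound with the mass of \<open>B\<close>, a set of
    \<open>\<pi>\<close> that contains \<open>S\<close>. By \<open>a_param\<close> the two sets
    differ only by a null set, so nothing is lost.\<close>
  have "measure (completion \<pi>) S \<le> measure (completion \<pi>) B"
    by (rule finite_measure.finite_measure_mono)
      (use B \<pi>.prob_space_completion in \<open>auto simp: S_def B_def prob_space_def\<close>)
  then have SB: "measure (completion \<pi>) S \<le> measure \<pi> B"
    using B by (simp add: measure_completion)
  \<comment> \<open>Exchanges "for large n, almost surely" into "almost surely, for large n".
    Guarding each inequality by its own almost sure validity makes it hold almost surely for every
    n, and countably many null sets are discarded together.\<close>
  have "AE \<omega> in P. \<forall>n. (AE \<omega> in P. T \<mu>star (\<nu>obs n (obs n \<omega>)) \<le> \<epsilon> * \<alpha> n)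
      \<longrightarrow> T \<mu>star (\<nu>obs n (obs n \<omega>)) \<le> \<epsilon> * \<alpha> n"
    by (subst AE_all_countable) auto
  then have AE_obs: "AE \<omega> in P. \<forall>\<^sub>F n in sequentially. T \<mu>star (\<nu>obs n (obs n \<omega>)) \<le> \<epsilon> * \<alpha> n"
    by eventually_elim (use a_obs in \<open>auto elim: eventually_mono\<close>)
  have "AE \<omega> in P. ereal ((1 - \<delta>) * measure \<pi> B)
      \<le> liminf (\<lambda>n. ereal (abc_posterior Y D \<mu> \<pi> n t (obs n \<omega>) B))"
    using AE_obs AE_space
  proof eventually_elim
    case (elim \<omega>)
    note Tn = elim(1)
    have ob: "obs n \<omega> \<in> samples Y n" if "n \<ge> 1" for n
      using obs[OF that elim(2)] .
    let ?f = "\<lambda>n \<theta>. measure (\<mu> n \<theta>) (disc_ball Y D n t (obs n \<omega>))"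
    let ?w = "\<lambda>n \<theta>. compat_weight \<mu> YS T \<nu>obs \<nu>sim \<epsilon>star \<epsilon> n (obs n \<omega>) \<theta>"
    let ?e = "\<lambda>n \<theta> l. measure (\<mu> n \<theta>) {z \<in> YS n \<theta>. T (\<nu>sim n \<theta> z) (\<nu>lim \<theta>) > \<epsilon> * l}"
    \<comment> \<open>The level \<open>l\<close> is quantified inside because it will be chosen
      depending on \<theta>. This costs no further null sets: the exceptional sets depend on
      \<open>n\<close> only.\<close>
    have "AE \<theta> in \<pi>. \<forall>n\<ge>1. \<forall>l. T \<mu>star (\<nu>obs n (obs n \<omega>)) + T \<mu>star (\<nu>lim \<theta>) + \<epsilon> * l \<le> \<epsilon>star + \<epsilon>
        \<longrightarrow> 1 - ?e n \<theta> l \<le> ?w n \<theta>"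
    proof (intro AE_all_countable[THEN iffD2] allI AE_impI)
      fix n :: nat assume n: "1 \<le> n"
      show "AE \<theta> in \<pi>. \<forall>l. T \<mu>star (\<nu>obs n (obs n \<omega>)) + T \<mu>star (\<nu>lim \<theta>) + \<epsilon> * l \<le> \<epsilon>star + \<epsilon>
          \<longrightarrow> 1 - ?e n \<theta> l \<le> ?w n \<theta>"
        using pseudo_samples[OF n] \<nu>sim_prob[OF n] \<Delta>_measurable[OF n ob[OF n]]
          \<nu>lim_prob T\<theta>n_measurable[OF n] AE_space
        by eventually_elim (use n ob[OF n] in \<open>auto intro!: compat_weight_ge simp: space_prior\<close>)
    qed
    moreover have "AE \<theta> in \<pi>. \<forall>n. (AE \<theta> in \<pi>. \<theta> \<in> \<Theta>\<epsilon> \<longrightarrow> \<alpha> n + \<beta> \<theta> + \<gamma> \<theta> n \<le> 1)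
        \<longrightarrow> \<theta> \<in> \<Theta>\<epsilon> \<longrightarrow> \<alpha> n + \<beta> \<theta> + \<gamma> \<theta> n \<le> 1"
      by (subst AE_all_countable) auto
    \<comment> \<open>The null set in (c) may vary with the sample, but \<omega> is fixed here, so
      only the countably many samples \<open>obs n \<omega>\<close> matter. The guard works as
      before.\<close>
    moreover have "AE \<theta> in \<pi>. \<forall>n. (AE \<theta> in \<pi>. \<theta> \<in> \<Theta>w \<longrightarrow> ?w n \<theta> \<le> ?f n \<theta>)
        \<longrightarrow> \<theta> \<in> \<Theta>w \<longrightarrow> ?w n \<theta> \<le> ?f n \<theta>"
      by (subst AE_all_countable) auto
    ultimately have lim: "AE \<theta> in \<pi>. \<theta> \<in> B \<longrightarrow> ereal (1 - \<delta>) \<le> liminf (\<lambda>n. ereal (?f n \<theta>))"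
      using a_param b d
    proof eventually_elim
      case (elim \<theta>)
      note weight = elim(1) and coeffs = elim(2) and ball = elim(3)
        and param = elim(4) and pos = elim(5) and conc = elim(6)
      show ?case
      proof
        assume \<theta>: "\<theta> \<in> B"
        have in_sets: "\<theta> \<in> \<Theta>\<epsilon>" "\<theta> \<in> \<Theta>w" "\<theta> \<in> \<Theta>\<delta>" using \<theta> by (auto simp: B_def I_def)
        have "0 < liminf (\<lambda>n. ereal (\<gamma> \<theta> n))" using pos in_sets by blast
        then obtain l' where l': "0 < ereal l'" "ereal l' < liminf (\<lambda>n. ereal (\<gamma> \<theta> n))"
          using ereal_dense2 by blast
        \<comment> \<open>(d) needs a level that does not vary with \<open>n\<close>, whereas
          \<open>\<gamma> \<theta> n\<close> does; a constant below its lower limit serves. The cap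
          1/2 keeps the level below 1.\<close>
        define l where "l = min l' (1/2)"
        have l: "l \<in> {0<..<1}" using l' by (auto simp: l_def)
        have ev_\<gamma>: "\<forall>\<^sub>F n in sequentially. l \<le> \<gamma> \<theta> n"
          using less_LiminfD[OF l'(2)] by eventually_elim (auto simp: l_def)
        have ev_coeffs: "\<forall>\<^sub>F n in sequentially. \<alpha> n + \<beta> \<theta> + \<gamma> \<theta> n \<le> 1"
          using a_coeffs
        proof eventually_elim
          case (elim n)
          then have "AE \<theta> in \<pi>. \<theta> \<in> \<Theta>\<epsilon> \<longrightarrow> \<alpha> n + \<beta> \<theta> + \<gamma> \<theta> n \<le> 1"
            by eventually_elim simp
          then show ?case
            using coeffs in_sets by blast
        qed
        have "limsup (\<lambda>n. ereal (?e n \<theta> l)) \<le> ereal \<delta>"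
          using conc in_sets l by blast
        moreover have "\<forall>\<^sub>F n in sequentially. 1 - ?e n \<theta> l \<le> ?f n \<theta>"
          using ev_\<gamma> ev_coeffs c Tn
            eventually_ge_at_top[of 1]
        proof eventually_elim
          case (elim n)
          \<comment> \<open>The excess \<epsilon> is split into shares for the observed sample, the
            parameter and the pseudo-sample; lowering the last share from
            \<open>\<gamma> \<theta> n\<close> to \<open>l\<close> keeps the sum within
            \<epsilon>.\<close>
          have "\<epsilon> * \<alpha> n + \<epsilon> * \<beta> \<theta> + \<epsilon> * l \<le> \<epsilon> * (\<alpha> n + \<beta> \<theta> + \<gamma> \<theta> n)"
            using elim(1) \<epsilon> by (simp add: algebra_simps)
          also have "\<dots> \<le> \<epsilon>"
            using elim(2) \<epsilon> by (simp add: mult_left_le)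
          finally have "T \<mu>star (\<nu>obs n (obs n \<omega>)) + T \<mu>star (\<nu>lim \<theta>) + \<epsilon> * l \<le> \<epsilon>star + \<epsilon>"
            using elim(4) param in_sets by linarith
          then have "1 - ?e n \<theta> l \<le> ?w n \<theta>"
            using weight elim(5) by blast
          also have "?w n \<theta> \<le> ?f n \<theta>"
            using ball elim(3)[folded t_def] ob[OF elim(5)] in_sets by blast
          finally show ?case .
        qed
        ultimately show "ereal (1 - \<delta>) \<le> liminf (\<lambda>n. ereal (?f n \<theta>))"
          by (rule one_minus_le_liminf)
      qed
    qed
    \<comment> \<open>Nothing is known of \<open>?f\<close> at \<open>n = 0\<close> or outside
      \<Theta>, while Fatou's lemma above asks for measurability and a bound for all indices and
      points. The truncation supplies these and changes nothing for \<open>n \<ge> 1\<close> on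
      \<Theta>.\<close>
    define g where "g n \<theta> = min 1 (if n = 0 then 0 else ?f n \<theta>)" for n \<theta>
    have g_eq: "g n \<theta> = ?f n \<theta>" if "n \<ge> 1" "\<theta> \<in> \<Theta>" for n \<theta>
      using model[OF that] that by (simp add: g_def prob_measures_def prob_space.prob_le_1)
    have "ereal ((1 - \<delta>) * measure \<pi> B) \<le> liminf (\<lambda>n. ereal (LINT \<theta>:B|\<pi>. g n \<theta>))"
    proof (rule \<pi>.liminf_set_integral_ge[where b=1])
      show "g n \<in> borel_measurable \<pi>" for n
      proof (cases "n = 0")
        case False
        then have "?f n \<in> borel_measurable \<pi>"
          by (intro measurable_prob_measures[OF prior ball_measurable[OF _ ob t]]) simp_all
        then show ?thesis using False by (simp add: g_def[abs_def])
      qed (simp add: g_def[abs_def])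
      show "AE \<theta> in \<pi>. \<theta> \<in> B \<longrightarrow> ereal (1 - \<delta>) \<le> liminf (\<lambda>n. ereal (g n \<theta>))"
        using lim AE_space
      proof eventually_elim
        case (elim \<theta>)
        have "liminf (\<lambda>n. ereal (g n \<theta>)) = liminf (\<lambda>n. ereal (?f n \<theta>))"
          by (rule Liminf_eq, use eventually_ge_at_top[of 1] in eventually_elim)
            (use elim g_eq space_prior in auto)
        with elim show ?case by simp
      qed
    qed (use B d_delta in \<open>auto simp: g_def\<close>)
    also have "\<dots> \<le> liminf (\<lambda>n. ereal (abc_posterior Y D \<mu> \<pi> n t (obs n \<omega>) B))"
    proof (rule Liminf_mono, use eventually_ge_at_top[of 1] in eventually_elim)
      case (elim n)
      have "(LINT \<theta>:B|\<pi>. g n \<theta>) = (LINT \<theta>:B|\<pi>. ?f n \<theta>)"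
        unfolding set_lebesgue_integral_def
        by (rule Bochner_Integration.integral_cong) (use g_eq[OF elim] space_prior in auto)
      also have "\<dots> \<le> abc_posterior Y D \<mu> \<pi> n t (obs n \<omega>) B"
        by (rule abc_posterior_ge[OF elim ob[OF elim] t])
      finally show ?case by simp
    qed
    finally show ?case .
  qed
  then have "AE \<omega> in P. ereal ((1 - \<delta>) * measure (completion \<pi>) S)
        \<le> liminf (\<lambda>n. ereal (abc_posterior Y D \<mu> \<pi> n t (obs n \<omega>) B))
      \<and> (measure (completion \<pi>) S > 0
        \<longrightarrow> liminf (\<lambda>n. ereal (abc_posterior Y D \<mu> \<pi> n t (obs n \<omega>) B)) > 0)"
  proof eventually_elim
    case (elim \<omega>)
    have "ereal ((1 - \<delta>) * measure (completion \<pi>) S) \<le> ereal ((1 - \<delta>) * measure \<pi> B)"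
      using SB d_delta by (simp add: mult_left_mono)
    also note elim
    finally have le: "ereal ((1 - \<delta>) * measure (completion \<pi>) S)
        \<le> liminf (\<lambda>n. ereal (abc_posterior Y D \<mu> \<pi> n t (obs n \<omega>) B))" .
    \<comment> \<open>Strict positivity survives the factor 1 - \<delta> because \<delta> <
      1.\<close>
    have "0 < ereal ((1 - \<delta>) * measure (completion \<pi>) S)" if "measure (completion \<pi>) S > 0"
      using that d_delta by simp
    with le show ?case by (blast intro: less_le_trans)
  qed
  then show ?thesis
    by (simp add: B_def S_def I_def t_def)
qed

end
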